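(* Let $\mathcal H$ be a real Hilbert space, let $f,g\in\Gamma_0(\mathcal H)$ be such that $\operatorname{lev}_{\leq 0}f\neq\varnothing$ and $\operatorname{lev}_{\leq 0}g\neq\varnothing$, let $\alpha\in\,]0,1[$, and set $h_\alpha=\alpha f+(1-\alpha)g$. Suppose that $\operatorname{lev}_{\leq 0}f\cap\operatorname{lev}_{\leq 0}g\neq\varnothing$ and that there exists $x\in\mathcal H$ with $\partial f(x)\cap\partial g(x)\neq\varnothing$. Let $U$ be a selection of $x\mapsto\partial f(x)\cap\partial g(x)$. Then: (i) $G_{h_\alpha}^U$ is well defined, i.e. $h_\alpha\in\Gamma_0(\mathcal H)$, $\operatorname{lev}_{\leq 0}h_\alpha\neq\varnothing$ and $U$ is a selection of $\partial h_\alpha$. (ii) $(\operatorname{dom}G_f^U)\cap(\operatorname{dom}G_g^U)\subset\operatorname{dom}G_{h_\alpha}^U$. (iii) For every $x\in(\operatorname{dom}G_f^U)\cap(\operatorname{dom}G_g^U)$, $$G_{h_\alpha}^Ux=\alpha G_f^Ux+(1-\alpha)G_g^Ux\iff f(x)g(x)\geq 0 .$$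
   Context: $\Gamma_0(\mathcal H)$ is the set of proper convex lower semicontinuous functions $\mathcal H\to]-\infty,+\infty]$; $\operatorname{lev}_{\leq 0}f=\{x: f(x)\leq 0\}$. $\partial f$ is the convex subdifferential. A selection of a set-valued operator $A:\mathcal H\to2^{\mathcal H}$ is a map $U$ defined on some subset $\operatorname{dom}U\subset\{x:Ax\neq\varnothing\}$ with $Ux\in Ax$ for all $x\in\operatorname{dom}U$. For $f\in\Gamma_0(\mathcal H)$ with $\operatorname{lev}_{\leq 0}f\neq\varnothing$ and a selection $U$ of $\partial f$, $G_f^U$ is the single-valued map with domain $\operatorname{lev}_{\leq 0}f\cup\operatorname{dom}U$ given by $G_f^Ux=x$ if $f(x)\leq0$ and $G_f^Ux=x-\frac{f(x)}{\|Ux\|^2}Ux$ if $f(x)>0$ and $x\in\operatorname{dom}U$ (subgradients at points where $f>0$ are nonzero because $\operatorname{lev}_{\leq 0}f\neq\varnothing$). *)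

theory Defs
  imports "HOL-Analysis.Analysis"
begin

text \<open>
  Functions \<open>\<H> \<rightarrow> ]-\<infinity>,+\<infinity>]\<close> are modelled as \<^typ>\<open>ereal\<close>-valued functions that never take
  the value \<open>-\<infinity>\<close>; this exclusion is part of properness.
\<close>

definition proper_fun :: "('a \<Rightarrow> ereal) \<Rightarrow> bool" where
  "proper_fun f \<longleftrightarrow> (\<forall>x. f x \<noteq> - \<infinity>) \<and> (\<exists>x. f x \<noteq> \<infinity>)"

text \<open>
  The parameter is restricted to \<open>]0,1[\<close>. The inequality is only used for functions avoiding
  \<open>-\<infinity>\<close>, so its right-hand side is never of the form \<open>\<infinity> - \<infinity>\<close>.
\<close>

definition ereal_convex :: "('a::real_vector \<Rightarrow> ereal) \<Rightarrow> bool" where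
  "ereal_convex f \<longleftrightarrow>
    (\<forall>x y. \<forall>t::real. 0 < t \<longrightarrow> t < 1 \<longrightarrow>
      f ((1 - t) *\<^sub>R x + t *\<^sub>R y) \<le> ereal (1 - t) * f x + ereal t * f y)"

text \<open>
  \<open>Liminf (nhds x) f\<close> is the supremum of \<open>inf f(V)\<close> over the neighbourhoods \<open>V\<close> of \<open>x\<close>
  (with \<open>x\<close> itself in \<open>V\<close>).
\<close>

definition lower_semicont :: "('a::topological_space \<Rightarrow> ereal) \<Rightarrow> bool" where
  "lower_semicont f \<longleftrightarrow> (\<forall>x. f x \<le> Liminf (nhds x) f)"

definition Gamma0 :: "('a::real_normed_vector \<Rightarrow> ereal) set" where
  "Gamma0 = {f. proper_fun f \<and> ereal_convex f \<and> lower_semicont f}"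

definition lev0 :: "('a \<Rightarrow> ereal) \<Rightarrow> 'a set" where
  "lev0 f = {x. f x \<le> 0}"

definition subdifferential :: "('a::real_inner \<Rightarrow> ereal) \<Rightarrow> 'a \<Rightarrow> 'a set" where
  "subdifferential f x = {u. \<forall>y. ereal ((y - x) \<bullet> u) + f x \<le> f y}"

text \<open>
  Single-valued maps defined on a subset of the space are partial functions \<open>'a \<rightharpoonup> 'a\<close>.
  That the domain of a selection lies in \<open>{x. A x \<noteq> {}}\<close> follows from the membership condition.
\<close>

definition selection_of :: "('a \<Rightarrow> 'b set) \<Rightarrow> ('a \<rightharpoonup> 'b) \<Rightarrow> bool" where
  "selection_of A U \<longleftrightarrow> (\<forall>x\<in>dom U. the (U x) \<in> A x)"

text \<open>
  Intended for \<open>f \<in> Gamma0\<close> with \<open>lev0 f \<noteq> {}\<close> and \<open>U\<close> a selection of the subdifferential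
  of \<open>f\<close>. Then \<open>f x\<close> is finite on \<open>dom U\<close>, so \<^const>\<open>real_of_ereal\<close> loses nothing, and
  \<open>u \<noteq> 0\<close> whenever \<open>f x > 0\<close>, so the division is a genuine one.
\<close>

definition subgrad_proj :: "('a::real_inner \<Rightarrow> ereal) \<Rightarrow> ('a \<rightharpoonup> 'a) \<Rightarrow> ('a \<rightharpoonup> 'a)" where
  "subgrad_proj f U x =
    (if f x \<le> 0 then Some x
     else case U x of
       None \<Rightarrow> None
     | Some u \<Rightarrow> Some (x - (real_of_ereal (f x) / (norm u)\<^sup>2) *\<^sub>R u))"

lemma dom_subgrad_proj: "dom (subgrad_proj f U) = lev0 f \<union> dom U"
  by (auto simp: subgrad_proj_def lev0_def dom_def split: option.splits if_splits)

end

theory Submission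
  imports Defs
begin

text \<open>
  At a point with a common subgradient \<open>u\<close>, the functions \<open>f\<close>, \<open>g\<close> and \<open>h\<close> are finite and each of
  the three projections has the form \<open>x - (max a 0 / \<parallel>u\<parallel>\<^sup>2) u\<close>, where \<open>a\<close> is the value of the
  function at \<open>x\<close>. Hence the identity in (iii) says that the positive part is affine along the
  convex combination of the two values, which holds precisely when they do not have strictly
  opposite signs. Points of the domain without a subgradient lie in both level sets and are fixed
  by all three maps.
\<close>

lemma ereal_convex_scale:
  assumes "ereal_convex f" and "0 \<le> c"
  shows "ereal_convex (\<lambda>x. ereal c * f x)"
  unfolding ereal_convex_def
proof (intro allI impI)
  fix x y and t :: real
  assume t: "0 < t" "t < 1"
  have "ereal c * f ((1 - t) *\<^sub>R x + t *\<^sub>R y)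
      \<le> ereal c * (ereal (1 - t) * f x + ereal t * f y)"
    using assms t by (intro ereal_mult_left_mono) (auto simp: ereal_convex_def)
  also have "\<dots> = ereal (1 - t) * (ereal c * f x) + ereal t * (ereal c * f y)"
    \<comment> \<open>A finite nonnegative factor distributes over sums of extended reals even when
      a summand is infinite.\<close>
    using assms(2) by (simp add: ereal_pos_distrib mult.left_commute)
  finally show "ereal c * f ((1 - t) *\<^sub>R x + t *\<^sub>R y)
      \<le> ereal (1 - t) * (ereal c * f x) + ereal t * (ereal c * f y)" .
qed

lemma ereal_convex_add:
  assumes "ereal_convex f" and "ereal_convex g"
  shows "ereal_convex (\<lambda>x. f x + g x)"
  unfolding ereal_convex_def
proof (intro allI impI)
  fix x y and t :: real
  assume t: "0 < t" "t < 1"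
  have "f ((1 - t) *\<^sub>R x + t *\<^sub>R y) + g ((1 - t) *\<^sub>R x + t *\<^sub>R y)
      \<le> (ereal (1 - t) * f x + ereal t * f y) + (ereal (1 - t) * g x + ereal t * g y)"
    using assms t by (intro add_mono) (auto simp: ereal_convex_def)
  also have "\<dots> = ereal (1 - t) * (f x + g x) + ereal t * (f y + g y)"
    using t by (simp add: ereal_pos_distrib ac_simps)
  finally show "f ((1 - t) *\<^sub>R x + t *\<^sub>R y) + g ((1 - t) *\<^sub>R x + t *\<^sub>R y)
      \<le> ereal (1 - t) * (f x + g x) + ereal t * (f y + g y)" .
qed

lemma lower_semicont_scale:
  assumes "lower_semicont f" and "0 \<le> c"
  shows "lower_semicont (\<lambda>x. ereal c * f x)"
  using assms
  by (auto simp: lower_semicont_def Liminf_ereal_mult_left intro!: ereal_mult_left_mono)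

text \<open>Serves lower semicontinuity of sums: each of the two strict bounds persists on a
  neighbourhood. Finite summands share the slack; an infinite one absorbs whatever the other
  leaves.\<close>

lemma ereal_less_add_split:
  fixes p q y :: ereal
  assumes "y < p + q" and "p \<noteq> - \<infinity>" and "q \<noteq> - \<infinity>"
  obtains a b where "a < p" and "b < q" and "y \<le> a + b"
proof (cases y)
  case MInf
  with assms that[of "- \<infinity>" "- \<infinity>"] show ?thesis
    by auto
next
  case PInf
  with assms show ?thesis by simp
next
  case (real r)
  show ?thesis
  proof (cases p)
    case p: (real p')
    show ?thesis
    proof (cases q)
      case q: (real q')
      \<comment> \<open>Half the slack, so that the two lowered values add up to exactly
        \<open>r\<close>.\<close>
      define e where "e = (p' + q' - r) / 2"
      have "e > 0" using assms real p q by (simp add: e_def)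
      then show ?thesis
        using that[of "ereal (p' - e)" "ereal (q' - e)"] real p q by (simp add: e_def field_simps)
    next
      case PInf
      then show ?thesis
        using that[of "ereal (p' - 1)" "ereal (r - p' + 1)"] real p by simp
    qed (use assms in simp)
  next
    case PInf
    obtain b where "ereal b < q"
      using assms(3) by (metis ereal_dense2 ereal_infty_less(2))
    then show ?thesis
      using that[of "ereal (r - b)" "ereal b"] real PInf by simp
  qed (use assms in simp)
qed

lemma lower_semicont_add:
  assumes "lower_semicont f" and "lower_semicont g"
    and "\<And>x. f x \<noteq> - \<infinity>" and "\<And>x. g x \<noteq> - \<infinity>"
  shows "lower_semicont (\<lambda>x. f x + g x)"
  unfolding lower_semicont_def le_Liminf_iff
proof (intro allI impI)
  fix x y
  assume "y < f x + g x"
  then obtain a b where ab: "a < f x" "b < g x" "y \<le> a + b"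
    using assms(3,4) by (rule ereal_less_add_split)
  have "\<forall>\<^sub>F z in nhds x. a < f z" "\<forall>\<^sub>F z in nhds x. b < g z"
    using assms(1,2) ab by (auto simp: lower_semicont_def le_Liminf_iff)
  then show "\<forall>\<^sub>F z in nhds x. y < f z + g z"
    \<comment> \<open>Strictness comes from the two summands, so \<open>y \<le> a + b\<close> is
      enough.\<close>
    by eventually_elim (metis ab(3) ereal_add_strict_mono2 le_less_trans)
qed

lemma subdifferential_scale:
  assumes "u \<in> subdifferential f x" and "0 \<le> c"
  shows "c *\<^sub>R u \<in> subdifferential (\<lambda>x. ereal c * f x) x"
  unfolding subdifferential_def
proof (intro CollectI allI)
  fix y
  have "ereal c * (ereal ((y - x) \<bullet> u) + f x) \<le> ereal c * f y"
    using assms by (intro ereal_mult_left_mono) (auto simp: subdifferential_def)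
  then show "ereal ((y - x) \<bullet> (c *\<^sub>R u)) + ereal c * f x \<le> ereal c * f y"
    using assms(2) by (simp add: ereal_pos_distrib)
qed

lemma subdifferential_add:
  assumes "u \<in> subdifferential f x" and "v \<in> subdifferential g x"
  shows "u + v \<in> subdifferential (\<lambda>x. f x + g x) x"
  unfolding subdifferential_def
proof (intro CollectI allI)
  fix y
  have "(ereal ((y - x) \<bullet> u) + f x) + (ereal ((y - x) \<bullet> v) + g x) \<le> f y + g y"
    using assms by (intro add_mono) (auto simp: subdifferential_def)
  moreover have "ereal ((y - x) \<bullet> (u + v)) = ereal ((y - x) \<bullet> u) + ereal ((y - x) \<bullet> v)"
    by (simp add: inner_add_right)
  ultimately show "ereal ((y - x) \<bullet> (u + v)) + (f x + g x) \<le> f y + g y"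
    by (simp add: ac_simps)
qed

text \<open>The subgradient inequality, tested at a point where \<open>f\<close> is not \<infinity>,
  keeps \<open>f x\<close> below \<infinity>; properness excludes the value -\<infinity>.\<close>

lemma subdifferential_finite:
  assumes "proper_fun f" and "u \<in> subdifferential f x"
  obtains a where "f x = ereal a"
proof -
  obtain y where "f y \<noteq> \<infinity>"
    using assms(1) by (auto simp: proper_fun_def)
  moreover have "ereal ((y - x) \<bullet> u) + f x \<le> f y"
    using assms(2) by (simp add: subdifferential_def)
  ultimately have "f x \<noteq> \<infinity>" by auto
  then show ?thesis
    using assms(1) that by (cases "f x") (auto simp: proper_fun_def)
qed

text \<open>A zero subgradient would make \<open>x\<close> a global minimiser, putting
  \<open>f x\<close> below the value at a point of \<open>lev0 f\<close>.\<close>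

lemma subdifferential_pos_nonzero:
  assumes "u \<in> subdifferential f x" and "lev0 f \<noteq> {}" and "0 < f x"
  shows "u \<noteq> 0"
proof
  assume "u = 0"
  obtain y where "f y \<le> 0" using assms(2) by (auto simp: lev0_def)
  moreover have "f x \<le> f y"
    using assms(1) \<open>u = 0\<close> by (auto simp: subdifferential_def zero_ereal_def[symmetric])
  ultimately show False using assms(3) by simp
qed

text \<open>The positive part merges both branches of the definition: for \<open>a \<le> 0\<close>
  the coefficient vanishes and \<open>x\<close> stays fixed.\<close>

lemma subgrad_proj_finite:
  assumes "f x = ereal a" and "U x = Some u"
  shows "subgrad_proj f U x = Some (x - (max a 0 / (norm u)\<^sup>2) *\<^sub>R u)"
  using assms by (simp add: subgrad_proj_def max_def)

text \<open>Positive weights can be absorbed into the arguments without changing their signs. What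
  remains is that the positive part is additive on \<open>p\<close> and \<open>q\<close> exactly
  when they are not of strictly opposite signs.\<close>

lemma pos_part_convex_combination_iff:
  fixes a b \<alpha> :: real
  assumes "0 < \<alpha>" and "\<alpha> < 1"
  shows "max (\<alpha> * a + (1 - \<alpha>) * b) 0 = \<alpha> * max a 0 + (1 - \<alpha>) * max b 0 \<longleftrightarrow> 0 \<le> a * b"
proof -
  define p q where "p = \<alpha> * a" and "q = (1 - \<alpha>) * b"
  have max: "\<alpha> * max a 0 = max p 0" "(1 - \<alpha>) * max b 0 = max q 0"
    using assms by (simp_all add: p_def q_def max_mult_distrib_left)
  have sgn: "0 \<le> a * b \<longleftrightarrow> 0 \<le> p * q"
    using assms by (auto simp: p_def q_def zero_le_mult_iff mult_le_0_iff)
  show ?thesis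
    unfolding max sgn p_def[symmetric] q_def[symmetric]
    by (auto simp: zero_le_mult_iff max_def)
qed

theorem proposition2p16:
  fixes f g h :: "'h::{real_inner, complete_space} \<Rightarrow> ereal"
    and \<alpha> :: real
    and U :: "'h \<rightharpoonup> 'h"
  assumes "f \<in> Gamma0" and "g \<in> Gamma0"
    and "lev0 f \<noteq> {}" and "lev0 g \<noteq> {}"
    and "0 < \<alpha>" and "\<alpha> < 1"
    and "h = (\<lambda>x. ereal \<alpha> * f x + ereal (1 - \<alpha>) * g x)"
    and "lev0 f \<inter> lev0 g \<noteq> {}"
    and "\<exists>x. subdifferential f x \<inter> subdifferential g x \<noteq> {}"
    and "selection_of (\<lambda>x. subdifferential f x \<inter> subdifferential g x) U"
  shows "(h \<in> Gamma0 \<and> lev0 h \<noteq> {} \<and> selection_of (subdifferential h) U)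
    \<and> dom (subgrad_proj f U) \<inter> dom (subgrad_proj g U) \<subseteq> dom (subgrad_proj h U)
    \<and> (\<forall>x \<in> dom (subgrad_proj f U) \<inter> dom (subgrad_proj g U).
          the (subgrad_proj h U x)
            = \<alpha> *\<^sub>R the (subgrad_proj f U x) + (1 - \<alpha>) *\<^sub>R the (subgrad_proj g U x)
          \<longleftrightarrow> f x * g x \<ge> 0)"
proof (intro conjI ballI)
  have pf: "proper_fun f" and pg: "proper_fun g"
    using assms(1,2) by (auto simp: Gamma0_def)
  have nm: "ereal \<alpha> * f x \<noteq> - \<infinity>" "ereal (1 - \<alpha>) * g x \<noteq> - \<infinity>" for x
    using pf pg assms(5,6) by (auto simp: proper_fun_def)
  have lev: "h x \<le> 0" if "f x \<le> 0" "g x \<le> 0" for x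
  proof -
    have "ereal \<alpha> * f x \<le> 0" "ereal (1 - \<alpha>) * g x \<le> 0"
      using that assms(5,6) by (auto simp: ereal_mult_le_0_iff)
    then show ?thesis using assms(7) add_mono by fastforce
  qed
  show lh: "lev0 h \<noteq> {}"
    using lev assms(8) by (auto simp: lev0_def)
  show "h \<in> Gamma0"
  proof -
    have "h x \<noteq> - \<infinity>" for x
      using nm by (simp add: assms(7))
    \<comment> \<open>A point of the level set doubles as the point of finite value that properness
      requires.\<close>
    moreover obtain z where "h z \<le> 0"
      using lh by (auto simp: lev0_def)
    ultimately have "proper_fun h"
      unfolding proper_fun_def by (intro conjI allI exI[of _ z]) auto
    moreover have "ereal_convex h" "lower_semicont h"
      unfolding assms(7) using assms(1,2,5,6) nm
      by (intro ereal_convex_add ereal_convex_scale lower_semicont_add lower_semicont_scale;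
          simp add: Gamma0_def)+
    ultimately show ?thesis by (simp add: Gamma0_def)
  qed
  have sel: "u \<in> subdifferential f x" "u \<in> subdifferential g x" if "U x = Some u" for x u
    using assms(10) that by (force simp: selection_of_def)+
  have selh: "u \<in> subdifferential h x" if "U x = Some u" for x u
  proof -
    \<comment> \<open>Since \<open>u\<close> is a subgradient of both functions, the combination of
      subgradients collapses to \<open>u\<close> itself.\<close>
    have "\<alpha> *\<^sub>R u + (1 - \<alpha>) *\<^sub>R u \<in> subdifferential h x"
      unfolding assms(7) using sel[OF that] assms(5,6)
      by (intro subdifferential_add subdifferential_scale) auto
    then show ?thesis by (simp add: algebra_simps)
  qed
  then show "selection_of (subdifferential h) U"
    by (auto simp: selection_of_def)
  show "dom (subgrad_proj f U) \<inter> dom (subgrad_proj g U) \<subseteq> dom (subgrad_proj h U)"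
    unfolding dom_subgrad_proj using lev by (auto simp: lev0_def)
  fix x
  assume x: "x \<in> dom (subgrad_proj f U) \<inter> dom (subgrad_proj g U)"
  show "the (subgrad_proj h U x)
      = \<alpha> *\<^sub>R the (subgrad_proj f U x) + (1 - \<alpha>) *\<^sub>R the (subgrad_proj g U x)
    \<longleftrightarrow> f x * g x \<ge> 0"
  proof (cases "U x")
    case None
    then have "f x \<le> 0" "g x \<le> 0"
      using x unfolding dom_subgrad_proj by (auto simp: lev0_def)
    \<comment> \<open>Both sides of the equivalence are true here: all three maps fix
      \<open>x\<close>, and a product of two nonpositive values is nonnegative.\<close>
    then show ?thesis
      using lev by (auto simp: subgrad_proj_def ereal_zero_le_0_iff algebra_simps)
  next
    case (Some u)
    obtain a b where a: "f x = ereal a" and b: "g x = ereal b"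
      using sel[OF Some] pf pg by (metis subdifferential_finite)
    define c where "c = \<alpha> * a + (1 - \<alpha>) * b"
    have c: "h x = ereal c"
      by (simp add: assms(7) a b c_def)
    define P where "P t = max t 0" for t :: real
    \<comment> \<open>The weights sum to one, so the \<open>x\<close> terms cancel and only a
      multiple of \<open>u\<close> survives; it vanishes iff \<open>u = 0\<close> or the numerator
      does.\<close>
    have "the (subgrad_proj h U x)
        - (\<alpha> *\<^sub>R the (subgrad_proj f U x) + (1 - \<alpha>) *\<^sub>R the (subgrad_proj g U x))
      = ((\<alpha> * P a + (1 - \<alpha>) * P b - P c) / (norm u)\<^sup>2) *\<^sub>R u"
      unfolding subgrad_proj_finite[of f x _ U, OF a Some] subgrad_proj_finite[of g x _ U, OF b Some]
        subgrad_proj_finite[of h x _ U, OF c Some]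
        P_def[symmetric]
      by (simp add: algebra_simps diff_divide_distrib add_divide_distrib)
    then have "the (subgrad_proj h U x)
        = \<alpha> *\<^sub>R the (subgrad_proj f U x) + (1 - \<alpha>) *\<^sub>R the (subgrad_proj g U x)
      \<longleftrightarrow> u = 0 \<or> P c = \<alpha> * P a + (1 - \<alpha>) * P b"
      by (subst right_minus_eq[symmetric]) auto
    also have "\<dots> \<longleftrightarrow> P c = \<alpha> * P a + (1 - \<alpha>) * P b"
    proof -
      \<comment> \<open>The alternative \<open>u = 0\<close> adds nothing: it forces all three
        values to be nonpositive, so the equation reads 0 = 0.\<close>
      have "P a = 0 \<and> P b = 0 \<and> P c = 0" if "u = 0"
        using that subdifferential_pos_nonzero[OF sel(1)[OF Some] assms(3)]
          subdifferential_pos_nonzero[OF sel(2)[OF Some] assms(4)]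
          subdifferential_pos_nonzero[OF selh[OF Some] lh]
        by (force simp: a b c P_def max_def)
      then show ?thesis by auto
    qed
    also have "\<dots> \<longleftrightarrow> 0 \<le> a * b"
      unfolding P_def c_def by (rule pos_part_convex_combination_iff[OF assms(5,6)])
    finally show ?thesis by (simp add: a b)
  qed
qed

end
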